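(* Let $M$ be a compact Riemannian manifold and let $F:J_0^2(M)\to\mathbb{R}$ be continuous, (degenerate) elliptic, translation invariant and geometric. Then $\mathcal{F}(F)\neq\emptyset$; that is, there exists $f\in C^2([0,\infty))$ with $f(0)=f'(0)=f''(0)=0$, $f''(s)>0$ for $s>0$, and $$\lim_{|\zeta|\to0}\frac{f'(|\zeta|)}{|\zeta|}F(\zeta,2I)=\lim_{|\zeta|\to0}\frac{f'(|\zeta|)}{|\zeta|}F(\zeta,-2I)=0 .$$
   Context: $M$ is finite-dimensional, with norm $|\cdot|$ and distance $d$; $TM_x$, $TM_x^*$ are the tangent and cotangent spaces at $x$ (identified through the metric), $\mathcal{L}^2_s(TM_x)$ is the space of symmetric bilinear forms on $TM_x$, and $I$ is the identity (the metric). $J_0^2(M)=\bigcup_{x\in M}(TM_x^*\setminus\{0_x\})\times\mathcal{L}^2_s(TM_x)$. The limits are over $\zeta\in\bigcup_{x}(TM_x^*\setminus\{0_x\})$ with $|\zeta|\to0$. For $x,y$ close enough to be joined by a unique minimizing geodesic, $L_{xy}:TM_x\to TM_y$ is parallel translation along it; it induces isometries of cotangent spaces and of spaces of bilinear forms, with $L_{yx}(A)(v,w)=A(L_{xy}v,L_{xy}w)$ for $A\in\mathcal{L}^2_s(TM_y)$. $F$ is (degenerate) elliptic if $A\le B$ implies $F(\zeta,B)\le F(\zeta,A)$ for all $x\in M$, $\zeta\in TM_x^*\setminus\{0\}$, $A,B\in\mathcal{L}^2_s(TM_x)$; translation invariant if there is $\tau>0$ such that $F(L_{xy}\zeta,A)=F(\zeta,L_{yx}(A))$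 for all $x,y\in M$ with $d(x,y)<\tau$, $\zeta\in TM_x^*\setminus\{0\}$, $A\in\mathcal{L}^2_s(TM_y)$; geometric if $F(\lambda\zeta,\lambda A+\mu\,\zeta\otimes\zeta)=\lambda F(\zeta,A)$ for all $\lambda>0$, $\mu\in\mathbb{R}$. *)

theory Defs
  imports "HOL-Analysis.Analysis"
begin

section \<open>Smooth manifolds and tangent vectors\<close>

text \<open>
  A function on an open subset of a Euclidean space is of class \<open>C\<^sup>k\<^sup>+\<^sup>1\<close> iff it is differentiable
  and all its directional derivatives are of class \<open>C\<^sup>k\<close>.
\<close>

fun Ck_on :: "nat \<Rightarrow> 'e::euclidean_space set \<Rightarrow> ('e \<Rightarrow> 'b::real_normed_vector) \<Rightarrow> bool" where
  "Ck_on 0 S f \<longleftrightarrow> continuous_on S f"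
| "Ck_on (Suc k) S f \<longleftrightarrow>
     (\<exists>f'. (\<forall>x\<in>S. (f has_derivative f' x) (at x)) \<and> (\<forall>v. Ck_on k S (\<lambda>x. f' x v)))"

definition smooth_on :: "'e::euclidean_space set \<Rightarrow> ('e \<Rightarrow> 'b::real_normed_vector) \<Rightarrow> bool" where
  "smooth_on S f \<longleftrightarrow> (\<forall>k. Ck_on k S f)"

text \<open>
  A chart is a pair of its domain and the coordinate map (whose values outside of the domain are
  irrelevant). A tangent vector at \<open>x\<close> is the family of its coordinate representations in all charts
  around \<open>x\<close>, related by the derivatives of the coordinate changes; it is set to \<open>0\<close> on all other
  charts, so that equality of tangent vectors is equality of functions.
\<close>

type_synonym ('a, 'e) chart = "'a set \<times> ('a \<Rightarrow> 'e)"
type_synonym ('a, 'e) tvec = "('a, 'e) chart \<Rightarrow> 'e"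
type_synonym ('a, 'e) covec = "('a, 'e) tvec \<Rightarrow> real"
type_synonym ('a, 'e) bform = "('a, 'e) tvec \<Rightarrow> ('a, 'e) tvec \<Rightarrow> real"

record ('a, 'e) riem =
  mtop :: "'a topology"
  atlas :: "('a, 'e) chart set"
  rmetric :: "'a \<Rightarrow> ('a, 'e) bform"

definition charts_at :: "('a, 'e::euclidean_space) riem \<Rightarrow> 'a \<Rightarrow> ('a, 'e) chart set" where
  "charts_at M x = {c \<in> atlas M. x \<in> fst c}"

definition chart_inv :: "('a, 'e) chart \<Rightarrow> 'e \<Rightarrow> 'a" where
  "chart_inv c = inv_into (fst c) (snd c)"

definition transition :: "('a, 'e) chart \<Rightarrow> ('a, 'e) chart \<Rightarrow> 'e \<Rightarrow> 'e" where
  "transition c c' = snd c' \<circ> chart_inv c"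

definition smooth_manifold :: "('a, 'e::euclidean_space) riem \<Rightarrow> bool" where
  "smooth_manifold M \<longleftrightarrow>
     Hausdorff_space (mtop M) \<and> second_countable (mtop M) \<and>
     \<Union> (fst ` atlas M) = topspace (mtop M) \<and>
     (\<forall>c\<in>atlas M. openin (mtop M) (fst c) \<and> open (snd c ` fst c) \<and>
        homeomorphic_map (subtopology (mtop M) (fst c)) (top_of_set (snd c ` fst c)) (snd c)) \<and>
     (\<forall>c\<in>atlas M. \<forall>c'\<in>atlas M. smooth_on (snd c ` (fst c \<inter> fst c')) (transition c c'))"

definition tangent_space :: "('a, 'e::euclidean_space) riem \<Rightarrow> 'a \<Rightarrow> ('a, 'e) tvec set" where
  "tangent_space M x = {v.
     (\<forall>c. c \<notin> charts_at M x \<longrightarrow> v c = 0) \<and>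
     (\<forall>c\<in>charts_at M x. \<forall>c'\<in>charts_at M x.
        v c' = frechet_derivative (transition c c') (at (snd c x)) (v c))}"

text \<open>The tangent vector at \<open>x\<close> whose coordinate representation in the chart \<open>c\<close> is \<open>u\<close>.\<close>

definition tvec_of :: "('a, 'e::euclidean_space) riem \<Rightarrow> 'a \<Rightarrow> ('a, 'e) chart \<Rightarrow> 'e \<Rightarrow> ('a, 'e) tvec" where
  "tvec_of M x c u = (\<lambda>c'. if c' \<in> charts_at M x
     then frechet_derivative (transition c c') (at (snd c x)) u else 0)"

definition tcomb :: "real \<Rightarrow> ('a, 'e::euclidean_space) tvec \<Rightarrow> real \<Rightarrow> ('a, 'e) tvec \<Rightarrow> ('a, 'e) tvec" where
  "tcomb a v b w = (\<lambda>c. a *\<^sub>R v c + b *\<^sub>R w c)"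

text \<open>
  Covectors and bilinear forms are extended by \<open>0\<close> from the tangent space to the whole type, so that
  their equality is equality of functions.
\<close>

definition cotangent_space :: "('a, 'e::euclidean_space) riem \<Rightarrow> 'a \<Rightarrow> ('a, 'e) covec set" where
  "cotangent_space M x = {\<zeta>.
     (\<forall>v\<in>tangent_space M x. \<forall>w\<in>tangent_space M x. \<forall>a b.
        \<zeta> (tcomb a v b w) = a * \<zeta> v + b * \<zeta> w) \<and>
     (\<forall>v. v \<notin> tangent_space M x \<longrightarrow> \<zeta> v = 0)}"

definition nonzero_covectors :: "('a, 'e::euclidean_space) riem \<Rightarrow> 'a \<Rightarrow> ('a, 'e) covec set" where
  "nonzero_covectors M x = cotangent_space M x - {\<lambda>v. 0}"

definition sym_forms :: "('a, 'e::euclidean_space) riem \<Rightarrow> 'a \<Rightarrow> ('a, 'e) bform set" where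
  "sym_forms M x = {A.
     (\<forall>v. A v \<in> cotangent_space M x) \<and>
     (\<forall>v. v \<notin> tangent_space M x \<longrightarrow> A v = (\<lambda>w. 0)) \<and>
     (\<forall>v w. A v w = A w v)}"

section \<open>Riemannian metrics, distance and parallel translation\<close>

definition metric_coord :: "('a, 'e::euclidean_space) riem \<Rightarrow> ('a, 'e) chart \<Rightarrow> 'e \<Rightarrow> 'e \<Rightarrow> 'e \<Rightarrow> real" where
  "metric_coord M c p u w =
     (let x = chart_inv c p in rmetric M x (tvec_of M x c u) (tvec_of M x c w))"

definition riemannian_manifold :: "('a, 'e::euclidean_space) riem \<Rightarrow> bool" where
  "riemannian_manifold M \<longleftrightarrow>
     smooth_manifold M \<and>
     (\<forall>x\<in>topspace (mtop M). rmetric M x \<in> sym_forms M x \<and>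
        (\<forall>v\<in>tangent_space M x. v \<noteq> (\<lambda>c. 0) \<longrightarrow> rmetric M x v v > 0)) \<and>
     (\<forall>c\<in>atlas M. \<forall>u w. smooth_on (snd c ` fst c) (\<lambda>p. metric_coord M c p u w))"

definition tnorm :: "('a, 'e::euclidean_space) riem \<Rightarrow> 'a \<Rightarrow> ('a, 'e) tvec \<Rightarrow> real" where
  "tnorm M x v = sqrt (rmetric M x v v)"

definition conorm :: "('a, 'e::euclidean_space) riem \<Rightarrow> 'a \<Rightarrow> ('a, 'e) covec \<Rightarrow> real" where
  "conorm M x \<zeta> = (SUP v\<in>{v \<in> tangent_space M x. tnorm M x v \<le> 1}. \<bar>\<zeta> v\<bar>)"

definition velocity ::
  "('a, 'e::euclidean_space) riem \<Rightarrow> (real \<Rightarrow> 'a) \<Rightarrow> real \<Rightarrow> ('a, 'e) tvec" where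
  "velocity M \<gamma> t = (\<lambda>c. if c \<in> charts_at M (\<gamma> t)
     then vector_derivative (snd c \<circ> \<gamma>) (at t within {0..1}) else 0)"

definition C1_curve ::
  "('a, 'e::euclidean_space) riem \<Rightarrow> real \<Rightarrow> real \<Rightarrow> (real \<Rightarrow> 'a) \<Rightarrow> bool" where
  "C1_curve M a b \<gamma> \<longleftrightarrow>
     continuous_map (top_of_set {a..b}) (mtop M) \<gamma> \<and>
     (\<forall>c\<in>atlas M. \<exists>D. continuous_on {t\<in>{a..b}. \<gamma> t \<in> fst c} D \<and>
        (\<forall>t\<in>{a..b}. \<gamma> t \<in> fst c \<longrightarrow>
           ((snd c \<circ> \<gamma>) has_vector_derivative D t) (at t within {a..b})))"

definition piecewise_C1_curve :: "('a, 'e::euclidean_space) riem \<Rightarrow> (real \<Rightarrow> 'a) \<Rightarrow> bool" where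
  "piecewise_C1_curve M \<gamma> \<longleftrightarrow>
     (\<exists>K. finite K \<and> {0, 1} \<subseteq> K \<and> K \<subseteq> {0..1} \<and>
        (\<forall>a\<in>K. \<forall>b\<in>K. a < b \<and> {a<..<b} \<inter> K = {} \<longrightarrow> C1_curve M a b \<gamma>))"

definition curve_length :: "('a, 'e::euclidean_space) riem \<Rightarrow> (real \<Rightarrow> 'a) \<Rightarrow> ennreal" where
  "curve_length M \<gamma> = (\<integral>\<^sup>+t\<in>{0..1}. ennreal (tnorm M (\<gamma> t) (velocity M \<gamma> t)) \<partial>lborel)"

text \<open>The distance is \<open>\<infinity>\<close> between points of different connected components.\<close>

definition rdist :: "('a, 'e::euclidean_space) riem \<Rightarrow> 'a \<Rightarrow> 'a \<Rightarrow> ennreal" where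
  "rdist M x y = (INF \<gamma>\<in>{\<gamma>. piecewise_C1_curve M \<gamma> \<and> \<gamma> 0 = x \<and> \<gamma> 1 = y}. curve_length M \<gamma>)"

text \<open>
  The Christoffel symbols of the Levi-Civita connection in a chart, as a bilinear map:
  \<open>christoffel M c p u w\<close> is the coordinate representation at \<open>p\<close> of \<open>\<nabla>\<^sub>U W\<close> for the vector fields
  \<open>U\<close>, \<open>W\<close> with constant coordinates \<open>u\<close>, \<open>w\<close>, determined by the Koszul formula
  (whose bracket terms vanish for such fields).
\<close>

definition metric_deriv ::
  "('a, 'e::euclidean_space) riem \<Rightarrow> ('a, 'e) chart \<Rightarrow> 'e \<Rightarrow> 'e \<Rightarrow> 'e \<Rightarrow> 'e \<Rightarrow> real" where
  "metric_deriv M c p z u w = frechet_derivative (\<lambda>q. metric_coord M c q u w) (at p) z"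

definition christoffel ::
  "('a, 'e::euclidean_space) riem \<Rightarrow> ('a, 'e) chart \<Rightarrow> 'e \<Rightarrow> 'e \<Rightarrow> 'e \<Rightarrow> 'e" where
  "christoffel M c p u w = (THE y. \<forall>z. metric_coord M c p y z =
     (metric_deriv M c p u w z + metric_deriv M c p w u z - metric_deriv M c p z u w) / 2)"

definition parallel_along ::
  "('a, 'e::euclidean_space) riem \<Rightarrow> (real \<Rightarrow> 'a) \<Rightarrow> (real \<Rightarrow> ('a, 'e) tvec) \<Rightarrow> bool" where
  "parallel_along M \<gamma> V \<longleftrightarrow>
     (\<forall>t\<in>{0..1}. V t \<in> tangent_space M (\<gamma> t) \<and>
        (\<forall>c\<in>charts_at M (\<gamma> t).
           ((\<lambda>s. V s c) has_vector_derivative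
              - christoffel M c (snd c (\<gamma> t)) (velocity M \<gamma> t c) (V t c)) (at t within {0..1})))"

definition geodesic :: "('a, 'e::euclidean_space) riem \<Rightarrow> (real \<Rightarrow> 'a) \<Rightarrow> bool" where
  "geodesic M \<gamma> \<longleftrightarrow> C1_curve M 0 1 \<gamma> \<and> parallel_along M \<gamma> (velocity M \<gamma>)"

definition minimizing_geodesic ::
  "('a, 'e::euclidean_space) riem \<Rightarrow> 'a \<Rightarrow> 'a \<Rightarrow> (real \<Rightarrow> 'a) \<Rightarrow> bool" where
  "minimizing_geodesic M x y \<gamma> \<longleftrightarrow>
     geodesic M \<gamma> \<and> \<gamma> 0 = x \<and> \<gamma> 1 = y \<and> curve_length M \<gamma> = rdist M x y"

definition unique_minimizing_geodesic :: "('a, 'e::euclidean_space) riem \<Rightarrow> 'a \<Rightarrow> 'a \<Rightarrow> bool" where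
  "unique_minimizing_geodesic M x y \<longleftrightarrow>
     (\<exists>\<gamma>. minimizing_geodesic M x y \<gamma> \<and>
        (\<forall>\<gamma>'. minimizing_geodesic M x y \<gamma>' \<longrightarrow> (\<forall>t\<in>{0..1}. \<gamma>' t = \<gamma> t)))"

definition parallel_transl ::
  "('a, 'e::euclidean_space) riem \<Rightarrow> 'a \<Rightarrow> 'a \<Rightarrow> ('a, 'e) tvec \<Rightarrow> ('a, 'e) tvec" where
  "parallel_transl M x y v = (THE w. \<exists>\<gamma> V. minimizing_geodesic M x y \<gamma> \<and>
     parallel_along M \<gamma> V \<and> V 0 = v \<and> V 1 = w)"

text \<open>
  \<open>L\<^sub>x\<^sub>y \<zeta>\<close> for covectors at \<open>x\<close>: under the identification of vectors and covectors through the metric,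
  the isometry \<open>L\<^sub>x\<^sub>y\<close>, with inverse \<open>L\<^sub>y\<^sub>x\<close>, acts as \<open>\<zeta> \<mapsto> \<zeta> \<circ> L\<^sub>y\<^sub>x\<close>.
\<close>

definition transl_covec ::
  "('a, 'e::euclidean_space) riem \<Rightarrow> 'a \<Rightarrow> 'a \<Rightarrow> ('a, 'e) covec \<Rightarrow> ('a, 'e) covec" where
  "transl_covec M x y \<zeta> =
     (\<lambda>w. if w \<in> tangent_space M y then \<zeta> (parallel_transl M y x w) else 0)"

text \<open>\<open>transl_form M y x A\<close> is the translation \<open>L\<^sub>y\<^sub>x A\<close> to \<open>x\<close> of a form \<open>A\<close> at \<open>y\<close>.\<close>

definition transl_form ::
  "('a, 'e::euclidean_space) riem \<Rightarrow> 'a \<Rightarrow> 'a \<Rightarrow> ('a, 'e) bform \<Rightarrow> ('a, 'e) bform" where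
  "transl_form M y x A = (\<lambda>v w. if v \<in> tangent_space M x \<and> w \<in> tangent_space M x
     then A (parallel_transl M x y v) (parallel_transl M x y w) else 0)"

section \<open>Functions on the 2-jet bundle\<close>

text \<open>
  A function on \<open>J\<^sub>0\<^sup>2(M)\<close> is represented as a function of the base point \<open>x\<close>, a nonzero covector \<open>\<zeta>\<close> at
  \<open>x\<close> and a symmetric form \<open>A\<close> at \<open>x\<close>; its values at other arguments are irrelevant. The topology of
  \<open>J\<^sub>0\<^sup>2(M)\<close> is the one for which the local trivializations
  \<open>(p, \<alpha>, B) \<mapsto> (x, covec_of M x c \<alpha>, form_of M x c B)\<close>, where \<open>x = chart_inv c p\<close>, induced by the charts
  \<open>c\<close> are homeomorphisms onto open sets, so continuity is continuity in all of them.
\<close>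

type_synonym ('a, 'e) jet_fun = "'a \<Rightarrow> ('a, 'e) covec \<Rightarrow> ('a, 'e) bform \<Rightarrow> real"

definition covec_of ::
  "('a, 'e::euclidean_space) riem \<Rightarrow> 'a \<Rightarrow> ('a, 'e) chart \<Rightarrow> ('e \<Rightarrow>\<^sub>L real) \<Rightarrow> ('a, 'e) covec" where
  "covec_of M x c \<alpha> = (\<lambda>v. if v \<in> tangent_space M x then blinfun_apply \<alpha> (v c) else 0)"

definition form_of ::
  "('a, 'e::euclidean_space) riem \<Rightarrow> 'a \<Rightarrow> ('a, 'e) chart \<Rightarrow> ('e \<Rightarrow>\<^sub>L 'e \<Rightarrow>\<^sub>L real) \<Rightarrow> ('a, 'e) bform" where
  "form_of M x c B = (\<lambda>v w. if v \<in> tangent_space M x \<and> w \<in> tangent_space M x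
     then blinfun_apply (blinfun_apply B (v c)) (w c) else 0)"

definition jet_continuous :: "('a, 'e::euclidean_space) riem \<Rightarrow> ('a, 'e) jet_fun \<Rightarrow> bool" where
  "jet_continuous M F \<longleftrightarrow>
     (\<forall>c\<in>atlas M. continuous_on
        {(p, \<alpha>, B). p \<in> snd c ` fst c \<and> \<alpha> \<noteq> 0 \<and>
           (\<forall>u w. blinfun_apply (blinfun_apply B u) w = blinfun_apply (blinfun_apply B w) u)}
        (\<lambda>(p, \<alpha>, B). let x = chart_inv c p in F x (covec_of M x c \<alpha>) (form_of M x c B)))"

definition degenerate_elliptic :: "('a, 'e::euclidean_space) riem \<Rightarrow> ('a, 'e) jet_fun \<Rightarrow> bool" where
  "degenerate_elliptic M F \<longleftrightarrow>
     (\<forall>x\<in>topspace (mtop M). \<forall>\<zeta>\<in>nonzero_covectors M x. \<forall>A\<in>sym_forms M x. \<forall>B\<in>sym_forms M x.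
        (\<forall>v\<in>tangent_space M x. A v v \<le> B v v) \<longrightarrow> F x \<zeta> B \<le> F x \<zeta> A)"

text \<open>
  The parallel translations only make sense for points joined by a unique minimizing geodesic (which
  on a compact manifold is the case for all sufficiently close points), so the condition is imposed
  on such pairs.
\<close>

definition translation_invariant :: "('a, 'e::euclidean_space) riem \<Rightarrow> ('a, 'e) jet_fun \<Rightarrow> bool" where
  "translation_invariant M F \<longleftrightarrow>
     (\<exists>\<tau>>0. \<forall>x\<in>topspace (mtop M). \<forall>y\<in>topspace (mtop M).
        rdist M x y < ennreal \<tau> \<and> unique_minimizing_geodesic M x y \<longrightarrow>
        (\<forall>\<zeta>\<in>nonzero_covectors M x. \<forall>A\<in>sym_forms M y.
           F y (transl_covec M x y \<zeta>) A = F x \<zeta> (transl_form M y x A)))"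

definition geometric :: "('a, 'e::euclidean_space) riem \<Rightarrow> ('a, 'e) jet_fun \<Rightarrow> bool" where
  "geometric M F \<longleftrightarrow>
     (\<forall>x\<in>topspace (mtop M). \<forall>\<zeta>\<in>nonzero_covectors M x. \<forall>A\<in>sym_forms M x. \<forall>l>0. \<forall>m.
        F x (\<lambda>v. l * \<zeta> v) (\<lambda>v w. l * A v w + m * (\<zeta> v * \<zeta> w)) = l * F x \<zeta> A)"

text \<open>
  The filter on pairs of a base point and a nonzero covector there which expresses that the norm of
  the covector tends to \<open>0\<close> (uniformly in the base point).
\<close>

definition covectors_to_0 :: "('a, 'e::euclidean_space) riem \<Rightarrow> ('a \<times> ('a, 'e) covec) filter" where
  "covectors_to_0 M = inf
     (filtercomap (\<lambda>(x, \<zeta>). conorm M x \<zeta>) (nhds 0))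
     (principal (SIGMA x:topspace (mtop M). nonzero_covectors M x))"

text \<open>
  The set \<open>\<F>(F)\<close>. Only the values of \<open>f\<close> on \<open>[0, \<infinity>)\<close> matter; the derivatives at \<open>0\<close> are one-sided.
\<close>

definition admissible_functions ::
  "('a, 'e::euclidean_space) riem \<Rightarrow> ('a, 'e) jet_fun \<Rightarrow> (real \<Rightarrow> real) set" where
  "admissible_functions M F = {f. \<exists>f' f''.
     (\<forall>s\<ge>0. (f has_real_derivative f' s) (at s within {0..})) \<and>
     (\<forall>s\<ge>0. (f' has_real_derivative f'' s) (at s within {0..})) \<and>
     continuous_on {0..} f'' \<and>
     f 0 = 0 \<and> f' 0 = 0 \<and> f'' 0 = 0 \<and> (\<forall>s>0. f'' s > 0) \<and>
     ((\<lambda>(x, \<zeta>). f' (conorm M x \<zeta>) / conorm M x \<zeta> * F x \<zeta> (\<lambda>v w. 2 * rmetric M x v w))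
        \<longlongrightarrow> 0) (covectors_to_0 M) \<and>
     ((\<lambda>(x, \<zeta>). f' (conorm M x \<zeta>) / conorm M x \<zeta> * F x \<zeta> (\<lambda>v w. - 2 * rmetric M x v w))
        \<longlongrightarrow> 0) (covectors_to_0 M)}"

end

theory Submission
  imports Defs
begin

text \<open>
  The two limits only ask \<open>f'\<close> to vanish at \<open>0\<close> fast enough to beat the growth of
  \<open>\<bar>F(\<zeta>, 2I)\<bar> + \<bar>F(\<zeta>, -2I)\<bar>\<close> as \<open>\<bar>\<zeta>\<bar> \<rightarrow> 0\<close>. This growth may be arbitrarily bad, but it is controlled away
  from \<open>0\<close>: the set of covectors with \<open>a \<le> \<bar>\<zeta>\<bar> \<le> 1\<close> is compact for every \<open>a > 0\<close>, since \<open>M\<close> is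
  compact, and \<open>F(\<zeta>, \<plusminus>2I)\<close> is continuous there, hence bounded.

  The boundedness (\<open>jet_fun_bounded\<close>) is shown chart by chart. Over a compact ball in a chart
  the metric is comparable to the Euclidean inner product, so the covectors with \<open>a \<le> \<bar>\<zeta>\<bar> \<le> b\<close>
  correspond to a subset of a compact set of pairs (point, nonzero linear functional), on which the
  coordinate expression of \<open>F(\<zeta>, k I)\<close> is continuous; finitely many such balls cover \<open>M\<close>.

  The function \<open>f\<close> is then obtained by choosing \<open>f''\<close>. The lemma \<open>flat_weight\<close> yields a
  continuous increasing \<open>g\<close> with \<open>g(0) = 0\<close>, \<open>g > 0\<close> on \<open>(0, \<infinity>)\<close> and
  \<open>g(\<bar>\<zeta>\<bar>) (\<bar>F(\<zeta>, 2I)\<bar> + \<bar>F(\<zeta>, -2I)\<bar>) \<le> \<bar>\<zeta>\<bar>\<close> for \<open>\<bar>\<zeta>\<bar> \<le> 1\<close>. With \<open>f'' = g\<close>, monotonicity gives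
  \<open>f'(s) = \<integral>\<^sub>0\<^sup>s g \<le> s g(s)\<close>, so both expressions in the limits are bounded by \<open>\<bar>\<zeta>\<bar>\<close> as soon as
  \<open>\<bar>\<zeta>\<bar> \<le> 1\<close>.
\<close>

section \<open>A weight that beats a locally bounded family\<close>

text \<open>
  The weight is an inf-convolution. Every index \<open>i\<close> with \<open>\<rho> i \<le> 1\<close> contributes the function
  \<open>s \<mapsto> \<rho> i / (1 + \<bar>\<Phi> i\<bar>) + max 0 (s - \<rho> i)\<close>, which is increasing, 1-Lipschitz, and at \<open>s = \<rho> i\<close> small
  enough to compensate \<open>\<Phi> i\<close>; the infimum of all of them inherits these three properties. It stays
  positive at \<open>s > 0\<close>: indices with \<open>\<rho> i \<le> s/2\<close> contribute at least \<open>s/2\<close>, and on the others \<open>\<Phi>\<close> is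
  bounded.
\<close>

lemma flat_weight:
  fixes \<rho> \<Phi> :: "'i \<Rightarrow> real"
  assumes pos: "\<And>i. i \<in> I \<Longrightarrow> \<rho> i > 0"
    and bdd: "\<And>a. a > 0 \<Longrightarrow> \<exists>B. \<forall>i\<in>I. a \<le> \<rho> i \<and> \<rho> i \<le> 1 \<longrightarrow> \<bar>\<Phi> i\<bar> \<le> B"
  obtains g :: "real \<Rightarrow> real"
  where "continuous_on UNIV g" "mono g" "g 0 = 0" "\<And>s. s > 0 \<Longrightarrow> g s > 0"
    "\<And>i. i \<in> I \<Longrightarrow> \<rho> i \<le> 1 \<Longrightarrow> g (\<rho> i) * \<bar>\<Phi> i\<bar> \<le> \<rho> i"
proof -
  \<comment> \<open>The extra index \<open>None\<close> plays the role of a point with \<open>\<rho> = 0\<close>: it forces \<open>g 0 = 0\<close> and makes the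
    family nonempty.\<close>
  define J where "J = insert None (Some ` {i\<in>I. \<rho> i \<le> 1})"
  define h :: "'i option \<Rightarrow> real \<Rightarrow> real" where
    "h = (\<lambda>j s. case j of None \<Rightarrow> max 0 s | Some i \<Rightarrow> \<rho> i / (1 + \<bar>\<Phi> i\<bar>) + max 0 (s - \<rho> i))"
  define g where "g = (\<lambda>s. INF j\<in>J. h j s)"
  have h_nonneg: "0 \<le> h j s" if "j \<in> J" for j s
    using that less_imp_le[OF pos]
    by (auto simp: J_def h_def split: option.split intro!: add_nonneg_nonneg divide_nonneg_nonneg)
  have bdd_h: "bdd_below ((\<lambda>j. h j s) ` J)" for s
    using h_nonneg by (intro bdd_belowI[of _ 0]) auto
  have ne: "J \<noteq> {}" by (simp add: J_def)
  have g_le: "g s \<le> h j s" if "j \<in> J" for j s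
    unfolding g_def by (rule cINF_lower[OF bdd_h that])
  have g_ge: "m \<le> g s" if "\<And>j. j \<in> J \<Longrightarrow> m \<le> h j s" for m s
    unfolding g_def by (rule cINF_greatest[OF ne that])
  have g_nonneg: "0 \<le> g s" for s
    by (rule g_ge) (rule h_nonneg)
  have lip: "g s \<le> g t + \<bar>s - t\<bar>" for s t
  proof -
    have "g s - \<bar>s - t\<bar> \<le> g t"
    proof (rule g_ge)
      fix j assume j: "j \<in> J"
      have "h j s \<le> h j t + \<bar>s - t\<bar>"
        by (auto simp: h_def split: option.split)
      with g_le[OF j, of s] show "g s - \<bar>s - t\<bar> \<le> h j t" by linarith
    qed
    then show ?thesis by simp
  qed
  have "continuous_on UNIV g"
  proof (rule continuous_onI)
    fix s e :: real assume "e > 0"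
    have "dist (g t) (g s) \<le> dist t s" for t
      using lip[of s t] lip[of t s] by (auto simp: dist_real_def)
    then show "\<exists>d>0. \<forall>t\<in>UNIV. dist t s < d \<longrightarrow> dist (g t) (g s) \<le> e"
      using \<open>e > 0\<close> by (meson less_eq_real_def order_trans)
  qed
  moreover have "mono g"
  proof (rule monoI, rule g_ge)
    fix s t :: real and j assume "s \<le> t" "j \<in> J"
    then have "h j s \<le> h j t" by (auto simp: h_def split: option.split)
    with g_le[OF \<open>j \<in> J\<close>, of s] show "g s \<le> h j t" by linarith
  qed
  moreover have "g 0 = 0"
    using g_le[of None 0] g_nonneg[of 0] by (simp add: J_def h_def)
  moreover have "g s > 0" if "s > 0" for s
  proof -
    obtain B where B: "\<forall>i\<in>I. s/2 \<le> \<rho> i \<and> \<rho> i \<le> 1 \<longrightarrow> \<bar>\<Phi> i\<bar> \<le> B"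
      using bdd[of "s/2"] \<open>s > 0\<close> by auto
    have "min (s/2) ((s/2) / (1 + \<bar>B\<bar>)) \<le> g s"
    proof (rule g_ge)
      fix j assume j: "j \<in> J"
      show "min (s/2) ((s/2) / (1 + \<bar>B\<bar>)) \<le> h j s"
      proof (cases j)
        case None
        then show ?thesis using \<open>s > 0\<close> by (auto simp: h_def)
      next
        case (Some i)
        then have i: "i \<in> I" "\<rho> i \<le> 1" using j by (auto simp: J_def)
        have nn: "0 \<le> \<rho> i / (1 + \<bar>\<Phi> i\<bar>)" using pos[OF i(1)] by simp
        show ?thesis
        proof (cases "\<rho> i \<le> s/2")
          case True
          then show ?thesis using nn Some by (auto simp: h_def)
        next
          case False
          then have "\<bar>\<Phi> i\<bar> \<le> \<bar>B\<bar>" using B i by force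
          then have "(s/2) / (1 + \<bar>B\<bar>) \<le> \<rho> i / (1 + \<bar>\<Phi> i\<bar>)"
            using False \<open>s > 0\<close> by (intro frac_le) auto
          then show ?thesis using Some by (auto simp: h_def)
        qed
      qed
    qed
    moreover have "0 < min (s/2) ((s/2) / (1 + \<bar>B\<bar>))" using \<open>s > 0\<close> by (simp add: field_simps)
    ultimately show ?thesis by linarith
  qed
  moreover have "g (\<rho> i) * \<bar>\<Phi> i\<bar> \<le> \<rho> i" if i: "i \<in> I" "\<rho> i \<le> 1" for i
  proof -
    have "g (\<rho> i) \<le> \<rho> i / (1 + \<bar>\<Phi> i\<bar>)"
      using g_le[of "Some i" "\<rho> i"] i by (auto simp: J_def h_def)
    then have "g (\<rho> i) * \<bar>\<Phi> i\<bar> \<le> \<rho> i / (1 + \<bar>\<Phi> i\<bar>) * \<bar>\<Phi> i\<bar>"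
      by (rule mult_right_mono) simp
    also have "\<dots> \<le> \<rho> i" using pos[OF i(1)] by (simp add: field_simps)
    finally show ?thesis .
  qed
  ultimately show ?thesis by (rule that)
qed

lemma integral_has_real_derivative_halfline:
  fixes g :: "real \<Rightarrow> real"
  assumes "continuous_on {0..} g" "s \<ge> 0"
  shows "((\<lambda>s. integral {0..s} g) has_real_derivative g s) (at s within {0..})"
proof -
  have "((\<lambda>s. integral {0..s} g) has_real_derivative g s) (at s within {0..s + 1})"
    using assms by (intro integral_has_real_derivative continuous_on_subset[OF assms(1)]) auto
  moreover have "at s within {0..s + 1} = at s within {0..}"
    by (rule at_within_nhd[of _ "{..<s + 1}"]) auto
  ultimately show ?thesis by simp
qed

section \<open>Tangent vectors and covectors in a chart\<close>

lemma inj_on_chart: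
  assumes "smooth_manifold M" "c \<in> atlas M"
  shows "inj_on (snd c) (fst c)"
proof -
  have "homeomorphic_map (subtopology (mtop M) (fst c)) (top_of_set (snd c ` fst c)) (snd c)"
    "openin (mtop M) (fst c)"
    using assms by (auto simp: smooth_manifold_def)
  from homeomorphic_imp_injective_map[OF this(1)] openin_subset[OF this(2)] show ?thesis
    by (simp add: Int_absorb1)
qed

lemma open_chart_overlap:
  assumes "smooth_manifold M" "c \<in> atlas M" "c' \<in> atlas M"
  shows "open (snd c ` (fst c \<inter> fst c'))"
proof -
  have *: "homeomorphic_map (subtopology (mtop M) (fst c)) (top_of_set (snd c ` fst c)) (snd c)"
    "open (snd c ` fst c)" "openin (mtop M) (fst c')"
    using assms by (auto simp: smooth_manifold_def)
  have "openin (subtopology (mtop M) (fst c)) (fst c \<inter> fst c')"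
    using *(3) by (metis inf_commute openin_subtopology)
  then have "openin (top_of_set (snd c ` fst c)) (snd c ` (fst c \<inter> fst c'))"
    using homeomorphic_imp_open_map[OF *(1)] by (simp add: open_map_def)
  then show ?thesis using *(2) by (simp add: openin_open_eq)
qed

lemma chart_inv_chart:
  assumes "smooth_manifold M" "c \<in> charts_at M x"
  shows "chart_inv c (snd c x) = x"
  using assms inj_on_chart[of M c] by (simp add: charts_at_def chart_inv_def inv_into_f_f)

lemma transition_chart:
  assumes "smooth_manifold M" "c \<in> charts_at M x"
  shows "transition c c' (snd c x) = snd c' x"
  by (simp add: transition_def chart_inv_chart[OF assms])

lemma transition_has_derivative:
  assumes "smooth_manifold M" "c \<in> charts_at M x" "c' \<in> charts_at M x"
  shows "(transition c c' has_derivative frechet_derivative (transition c c') (at (snd c x)))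
    (at (snd c x))"
proof -
  have "Ck_on (Suc 0) (snd c ` (fst c \<inter> fst c')) (transition c c')"
    using assms unfolding smooth_manifold_def smooth_on_def charts_at_def by blast
  moreover have "snd c x \<in> snd c ` (fst c \<inter> fst c')"
    using assms by (simp add: charts_at_def)
  ultimately have "transition c c' differentiable (at (snd c x))"
    unfolding Ck_on.simps differentiable_def by blast
  then show ?thesis by (simp add: frechet_derivative_works)
qed

text \<open>
  The chain rule for coordinate changes, which makes the family of coordinate representations built
  by \<open>tvec_of\<close> from a single one consistent.
\<close>

lemma frechet_derivative_transition_cocycle:
  assumes M: "smooth_manifold M"
    and c: "c \<in> charts_at M x" "c' \<in> charts_at M x" "c'' \<in> charts_at M x"
  shows "frechet_derivative (transition c c'') (at (snd c x)) =
    frechet_derivative (transition c' c'') (at (snd c' x)) \<circ>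
    frechet_derivative (transition c c') (at (snd c x))"
proof -
  let ?S = "snd c ` (fst c \<inter> fst c')"
  have "(transition c' c'' \<circ> transition c c' has_derivative
      frechet_derivative (transition c' c'') (at (snd c' x)) \<circ>
      frechet_derivative (transition c c') (at (snd c x))) (at (snd c x))"
    using transition_has_derivative[OF M c(1,2)] transition_has_derivative[OF M c(2,3)]
    by (intro diff_chain_at) (simp_all add: transition_chart[OF M c(1)])
  then have "(transition c c'' has_derivative
      frechet_derivative (transition c' c'') (at (snd c' x)) \<circ>
      frechet_derivative (transition c c') (at (snd c x))) (at (snd c x))"
  proof (rule has_derivative_transform_within_open)
    show "open ?S" using c by (intro open_chart_overlap[OF M]) (auto simp: charts_at_def)
    show "snd c x \<in> ?S" using c by (auto simp: charts_at_def)
    fix p assume "p \<in> ?S"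
    then obtain y where "p = snd c y" "c \<in> charts_at M y" "c' \<in> charts_at M y"
      using c by (auto simp: charts_at_def)
    then show "(transition c' c'' \<circ> transition c c') p = transition c c'' p"
      by (simp add: transition_chart[OF M])
  qed
  then show ?thesis
    by (rule has_derivative_unique[OF transition_has_derivative[OF M c(1,3)]])
qed

lemma frechet_derivative_transition_self:
  assumes M: "smooth_manifold M" and c: "c \<in> charts_at M x"
  shows "frechet_derivative (transition c c) (at (snd c x)) = (\<lambda>u. u)"
proof -
  let ?S = "snd c ` (fst c \<inter> fst c)"
  have "((\<lambda>p. p) has_derivative (\<lambda>u. u)) (at (snd c x))" by simp
  then have "(transition c c has_derivative (\<lambda>u. u)) (at (snd c x))"
  proof (rule has_derivative_transform_within_open)
    show "open ?S" using c by (intro open_chart_overlap[OF M]) (auto simp: charts_at_def)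
    show "snd c x \<in> ?S" using c by (auto simp: charts_at_def)
    fix p assume "p \<in> ?S"
    then obtain y where "p = snd c y" "c \<in> charts_at M y"
      using c by (auto simp: charts_at_def)
    then show "p = transition c c p" by (simp add: transition_chart[OF M])
  qed
  then show ?thesis
    by (rule has_derivative_unique[OF transition_has_derivative[OF M c c]])
qed

lemma tvec_of_in_tangent_space:
  assumes "smooth_manifold M" "c \<in> charts_at M x"
  shows "tvec_of M x c u \<in> tangent_space M x"
  unfolding tangent_space_def
proof (intro CollectI conjI allI ballI impI)
  fix c' c'' assume "c' \<in> charts_at M x" "c'' \<in> charts_at M x"
  then show "tvec_of M x c u c'' =
      frechet_derivative (transition c' c'') (at (snd c' x)) (tvec_of M x c u c')"
    unfolding tvec_of_def
    by (simp add: frechet_derivative_transition_cocycle[OF assms, of c' c''])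
qed (simp add: tvec_of_def)

lemma tvec_of_chart:
  assumes "smooth_manifold M" "c \<in> charts_at M x"
  shows "tvec_of M x c u c = u"
  using assms by (simp add: tvec_of_def frechet_derivative_transition_self)

lemma tvec_of_coordinate:
  assumes "c \<in> charts_at M x" "v \<in> tangent_space M x"
  shows "tvec_of M x c (v c) = v"
proof
  fix c'
  show "tvec_of M x c (v c) c' = v c'"
  proof (cases "c' \<in> charts_at M x")
    case True
    then have "v c' = frechet_derivative (transition c c') (at (snd c x)) (v c)"
      using assms unfolding tangent_space_def by blast
    with True show ?thesis by (simp only: tvec_of_def if_True)
  next
    case False
    then have "v c' = 0" using assms(2) unfolding tangent_space_def by blast
    with False show ?thesis by (simp only: tvec_of_def if_False)
  qed
qed

lemma tvec_of_tcomb: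
  assumes "smooth_manifold M" "c \<in> charts_at M x"
  shows "tvec_of M x c (a *\<^sub>R u + b *\<^sub>R w) = tcomb a (tvec_of M x c u) b (tvec_of M x c w)"
proof
  fix c'
  show "tvec_of M x c (a *\<^sub>R u + b *\<^sub>R w) c' = tcomb a (tvec_of M x c u) b (tvec_of M x c w) c'"
    using has_derivative_linear[OF transition_has_derivative[OF assms]]
    by (simp add: tvec_of_def tcomb_def linear_add linear_cmul)
qed

lemma linear_covector_coordinates:
  assumes M: "smooth_manifold M" and c: "c \<in> charts_at M x" and z: "\<zeta> \<in> cotangent_space M x"
  shows "linear (\<lambda>u. \<zeta> (tvec_of M x c u))"
proof -
  have "\<zeta> (tvec_of M x c (a *\<^sub>R u + b *\<^sub>R w)) = a * \<zeta> (tvec_of M x c u) + b * \<zeta> (tvec_of M x c w)"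
    for a b u w
    using z tvec_of_in_tangent_space[OF M c] by (simp add: tvec_of_tcomb[OF M c] cotangent_space_def)
  from this[of 1 _ 1] this[of _ _ 0 0] show ?thesis by (intro linearI) auto
qed

text \<open>
  Every covector lies in the range of the local trivialization, which is where continuity of a
  function on the jet bundle can be used.
\<close>

lemma covector_eq_covec_of:
  assumes M: "smooth_manifold M" and c: "c \<in> charts_at M x" and z: "\<zeta> \<in> cotangent_space M x"
  obtains \<alpha> where "\<zeta> = covec_of M x c \<alpha>"
proof
  have "bounded_linear (\<lambda>u. \<zeta> (tvec_of M x c u))"
    using linear_covector_coordinates[OF assms] linear_conv_bounded_linear by blast
  moreover have "\<zeta> v = 0" if "v \<notin> tangent_space M x" for v
    using z that unfolding cotangent_space_def by blast
  ultimately show "\<zeta> = covec_of M x c (Blinfun (\<lambda>u. \<zeta> (tvec_of M x c u)))"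
    by (intro ext) (simp add: covec_of_def bounded_linear_Blinfun_apply tvec_of_coordinate[OF c])
qed

section \<open>The metric in a chart\<close>

lemma bilinear_eq_blinfun:
  fixes b :: "'e::euclidean_space \<Rightarrow> 'e \<Rightarrow> real"
  assumes "bilinear b"
  shows "\<exists>B :: 'e \<Rightarrow>\<^sub>L 'e \<Rightarrow>\<^sub>L real. \<forall>u w. blinfun_apply (blinfun_apply B u) w = b u w"
proof -
  have bl: "bounded_linear (b u)" for u
    using assms linear_conv_bounded_linear unfolding bilinear_def by blast
  have "linear (\<lambda>u. Blinfun (b u))"
    by (intro linearI blinfun_eqI)
      (simp_all add: bl bounded_linear_Blinfun_apply blinfun.bilinear_simps
        bilinear_ladd[OF assms] bilinear_lmul[OF assms])
  then have "bounded_linear (\<lambda>u. Blinfun (b u))" using linear_conv_bounded_linear by blast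
  then show ?thesis
    by (intro exI[of _ "Blinfun (\<lambda>u. Blinfun (b u))"]) (simp add: bl bounded_linear_Blinfun_apply)
qed

lemma metric_coord_at:
  assumes "smooth_manifold M" "c \<in> charts_at M x"
  shows "metric_coord M c (snd c x) u w = rmetric M x (tvec_of M x c u) (tvec_of M x c w)"
  by (simp add: metric_coord_def chart_inv_chart[OF assms])

text \<open>
  The metric coefficients are smooth for each fixed pair of vectors; since the dimension is finite,
  this is enough for the metric to be continuous as a map into the normed space of bilinear forms,
  the space that parametrizes forms in the trivializations of the jet bundle.
\<close>

lemma metric_coord_blinfun:
  fixes M :: "('a, 'e::euclidean_space) riem"
  assumes M: "riemannian_manifold M" and c: "c \<in> atlas M"
  obtains G :: "'e \<Rightarrow> 'e \<Rightarrow>\<^sub>L 'e \<Rightarrow>\<^sub>L real"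
  where "continuous_on (snd c ` fst c) G"
    and "\<And>x u w. x \<in> fst c \<Longrightarrow>
      blinfun_apply (blinfun_apply (G (snd c x)) u) w = rmetric M x (tvec_of M x c u) (tvec_of M x c w)"
proof -
  have sm: "smooth_manifold M" using M by (simp add: riemannian_manifold_def)
  have ex: "\<exists>B::'e \<Rightarrow>\<^sub>L 'e \<Rightarrow>\<^sub>L real. \<forall>u w. blinfun_apply (blinfun_apply B u) w = metric_coord M c p u w"
    if p: "p \<in> snd c ` fst c" for p
  proof -
    obtain x where x: "x \<in> fst c" "p = snd c x" using p by auto
    then have cx: "c \<in> charts_at M x" using c by (simp add: charts_at_def)
    have "x \<in> topspace (mtop M)" using sm c x by (auto simp: smooth_manifold_def)
    then have R: "rmetric M x v \<in> cotangent_space M x" "rmetric M x v w = rmetric M x w v" for v w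
      using M unfolding riemannian_manifold_def sym_forms_def by blast+
    have l: "linear (\<lambda>w. metric_coord M c p u w)" for u
      unfolding x metric_coord_at[OF sm cx] by (rule linear_covector_coordinates[OF sm cx R(1)])
    moreover have "metric_coord M c p u w = metric_coord M c p w u" for u w
      unfolding x metric_coord_at[OF sm cx] by (rule R(2))
    ultimately have "bilinear (metric_coord M c p)" unfolding bilinear_def by simp
    then show ?thesis by (rule bilinear_eq_blinfun)
  qed
  then obtain G :: "'e \<Rightarrow> 'e \<Rightarrow>\<^sub>L 'e \<Rightarrow>\<^sub>L real" where
    G: "\<And>p u w. p \<in> snd c ` fst c \<Longrightarrow> blinfun_apply (blinfun_apply (G p) u) w = metric_coord M c p u w"
    by metis
  show ?thesis
  proof
    show "continuous_on (snd c ` fst c) G"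
    proof (intro continuous_on_blinfun_componentwise)
      fix i j :: 'e
      have "Ck_on 0 (snd c ` fst c) (\<lambda>p. metric_coord M c p i j)"
        using M c unfolding riemannian_manifold_def smooth_on_def by blast
      then show "continuous_on (snd c ` fst c) (\<lambda>p. blinfun_apply (blinfun_apply (G p) i) j)"
        by (simp add: G cong: continuous_on_cong_simp)
    qed
    show "blinfun_apply (blinfun_apply (G (snd c x)) u) w = rmetric M x (tvec_of M x c u) (tvec_of M x c w)"
      if "x \<in> fst c" for x u w
      using that c by (simp add: G charts_at_def metric_coord_at[OF sm])
  qed
qed

text \<open>
  Forms are extended by \<open>0\<close> outside of the tangent space, and so is the metric as an element of
  \<open>sym_forms\<close>; therefore the two sides agree as functions on the whole type.
\<close>

lemma metric_eq_form_of:
  assumes M: "riemannian_manifold M" and c: "c \<in> charts_at M x"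
    and B: "\<And>u w. blinfun_apply (blinfun_apply B u) w = rmetric M x (tvec_of M x c u) (tvec_of M x c w)"
  shows "form_of M x c (k *\<^sub>R B) = (\<lambda>v w. k * rmetric M x v w)"
proof -
  have "smooth_manifold M" using M by (simp add: riemannian_manifold_def)
  then have "x \<in> topspace (mtop M)" using c by (auto simp: smooth_manifold_def charts_at_def)
  then have "rmetric M x \<in> sym_forms M x" using M unfolding riemannian_manifold_def by blast
  then have "rmetric M x v w = 0" if "v \<notin> tangent_space M x \<or> w \<notin> tangent_space M x" for v w
    using that unfolding sym_forms_def by (metis (mono_tags, lifting) mem_Collect_eq)
  then show ?thesis
    using tvec_of_coordinate[OF c]
    by (intro ext) (auto simp: form_of_def blinfun.scaleR_left B)
qed

text \<open>
  Comparability of the metric with the Euclidean norm dualizes to comparability of the dual norm with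
  the operator norm. The first bound also shows that the supremum defining \<open>conorm\<close> is finite, which
  the second one needs; there the supremum is tested with vectors of Euclidean norm \<open>1 / sqrt L\<close>,
  whose Riemannian norm is at most \<open>1\<close>.
\<close>

lemma conorm_covec_of_bounds:
  assumes M: "riemannian_manifold M" and c: "c \<in> charts_at M x"
    and l: "l > 0" and L: "L > 0"
    and lo: "\<And>u. l * (norm u)\<^sup>2 \<le> rmetric M x (tvec_of M x c u) (tvec_of M x c u)"
    and up: "\<And>u. rmetric M x (tvec_of M x c u) (tvec_of M x c u) \<le> L * (norm u)\<^sup>2"
  shows "conorm M x (covec_of M x c \<alpha>) \<le> norm \<alpha> / sqrt l"
    and "norm \<alpha> \<le> sqrt L * conorm M x (covec_of M x c \<alpha>)"
proof -
  have sm: "smooth_manifold M" using M by (simp add: riemannian_manifold_def)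
  let ?T = "\<lambda>u. tvec_of M x c u"
  let ?S = "{v \<in> tangent_space M x. tnorm M x v \<le> 1}"
  have T: "?T u \<in> tangent_space M x" for u by (rule tvec_of_in_tangent_space[OF sm c])
  have lo': "sqrt l * norm u \<le> tnorm M x (?T u)" for u
    using real_sqrt_le_mono[OF lo[of u]] l by (simp add: tnorm_def real_sqrt_mult)
  have up': "tnorm M x (?T u) \<le> sqrt L * norm u" for u
    using real_sqrt_le_mono[OF up[of u]] by (simp add: tnorm_def real_sqrt_mult)
  have cov: "covec_of M x c \<alpha> (?T u) = blinfun_apply \<alpha> u" for u
    using T by (simp add: covec_of_def tvec_of_chart[OF sm c])
  have bound: "\<bar>covec_of M x c \<alpha> v\<bar> \<le> norm \<alpha> / sqrt l" if "v \<in> ?S" for v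
  proof -
    have v: "?T (v c) = v" using that tvec_of_coordinate[OF c] by simp
    have "sqrt l * norm (v c) \<le> 1" using lo'[of "v c"] that v by simp
    then have "norm (v c) \<le> 1 / sqrt l" using l by (simp add: field_simps)
    moreover have "\<bar>covec_of M x c \<alpha> v\<bar> \<le> norm \<alpha> * norm (v c)"
      using cov[of "v c"] v norm_blinfun[of \<alpha> "v c"] by simp
    moreover have "norm \<alpha> * norm (v c) \<le> norm \<alpha> * (1 / sqrt l)"
      using calculation(1) by (rule mult_left_mono) simp
    ultimately show ?thesis by simp
  qed
  have T0: "?T 0 \<in> ?S"
    using T lo[of 0] up[of 0] by (simp add: tnorm_def)
  then have ne: "?S \<noteq> {}" by blast
  show "conorm M x (covec_of M x c \<alpha>) \<le> norm \<alpha> / sqrt l"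
    unfolding conorm_def by (rule cSUP_least[OF ne bound])
  have "bdd_above ((\<lambda>v. \<bar>covec_of M x c \<alpha> v\<bar>) ` ?S)"
    using bound by (intro bdd_aboveI[of _ "norm \<alpha> / sqrt l"]) auto
  then have le_conorm: "\<bar>covec_of M x c \<alpha> v\<bar> \<le> conorm M x (covec_of M x c \<alpha>)" if "v \<in> ?S" for v
    unfolding conorm_def using that by (rule cSUP_upper2) simp
  have conorm0: "0 \<le> conorm M x (covec_of M x c \<alpha>)"
    using le_conorm[OF T0] by linarith
  show "norm \<alpha> \<le> sqrt L * conorm M x (covec_of M x c \<alpha>)"
  proof (rule norm_blinfun_bound)
    show "0 \<le> sqrt L * conorm M x (covec_of M x c \<alpha>)" using conorm0 L by simp
    fix u :: 'b
    show "norm (blinfun_apply \<alpha> u) \<le> sqrt L * conorm M x (covec_of M x c \<alpha>) * norm u"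
    proof (cases "u = 0")
      case False
      let ?r = "sqrt L * norm u"
      have r: "?r > 0" using False L by simp
      have "norm (u /\<^sub>R ?r) = norm u / ?r" using r
        by (simp only: norm_scaleR abs_inverse abs_of_pos divide_inverse mult.commute)
      then have "sqrt L * norm (u /\<^sub>R ?r) = 1" by (simp only:) (use L False in simp)
      then have "?T (u /\<^sub>R ?r) \<in> ?S" using T up'[of "u /\<^sub>R ?r"] by simp
      from le_conorm[OF this] have "\<bar>blinfun_apply \<alpha> u\<bar> / ?r \<le> conorm M x (covec_of M x c \<alpha>)"
        unfolding cov blinfun.scaleR_right real_scaleR_def
        by (simp only: mult.commute[of "inverse _"] divide_inverse[symmetric] abs_divide abs_of_pos[OF r])
      then have "\<bar>blinfun_apply \<alpha> u\<bar> \<le> conorm M x (covec_of M x c \<alpha>) * ?r"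
        using r by (simp only: pos_divide_le_eq)
      then show ?thesis by (simp add: mult_ac)
    qed simp
  qed
qed


text \<open>
  The quadratic form of the metric is continuous and positive on the compact set of pairs of a point
  of \<open>K\<close> and a Euclidean unit vector, so \<open>l\<close> and \<open>L\<close> can be its minimum and maximum there; homogeneity
  extends the bounds to all vectors.
\<close>

lemma metric_uniformly_equivalent_on_compact:
  fixes M :: "('a, 'e::euclidean_space) riem" and G :: "'e \<Rightarrow> 'e \<Rightarrow>\<^sub>L 'e \<Rightarrow>\<^sub>L real"
  assumes M: "riemannian_manifold M" and c: "c \<in> atlas M"
    and K: "compact K" "K \<noteq> {}" "K \<subseteq> snd c ` fst c" and contG: "continuous_on K G"
    and G: "\<And>x u w. x \<in> fst c \<Longrightarrow>
      blinfun_apply (blinfun_apply (G (snd c x)) u) w = rmetric M x (tvec_of M x c u) (tvec_of M x c w)"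
  obtains l L where "l > 0" "L > 0"
    "\<And>p u. p \<in> K \<Longrightarrow> l * (norm u)\<^sup>2 \<le> blinfun_apply (blinfun_apply (G p) u) u"
    "\<And>p u. p \<in> K \<Longrightarrow> blinfun_apply (blinfun_apply (G p) u) u \<le> L * (norm u)\<^sup>2"
proof -
  have sm: "smooth_manifold M" using M by (simp add: riemannian_manifold_def)
  let ?q = "\<lambda>(p, u). blinfun_apply (blinfun_apply (G p) u) u"
  let ?S = "K \<times> sphere (0::'e) 1"
  have cont: "continuous_on ?S ?q"
    unfolding case_prod_unfold
    by (intro continuous_intros continuous_on_compose2[OF contG]) auto
  have comp: "compact ?S" using K by (intro compact_Times) auto
  have "sphere (0::'e) 1 \<noteq> {}" by simp
  then have ne: "?S \<noteq> {}" using K(2) by blast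
  obtain z where z: "z \<in> ?S" "\<And>y. y \<in> ?S \<Longrightarrow> ?q z \<le> ?q y"
    using continuous_attains_inf[OF comp ne cont] by blast
  obtain z' where z': "\<And>y. y \<in> ?S \<Longrightarrow> ?q y \<le> ?q z'"
    using continuous_attains_sup[OF comp ne cont] by blast
  have "?q z > 0"
  proof -
    obtain p u where pu: "z = (p, u)" "p \<in> K" "norm u = 1" using z(1) by auto
    then obtain x where x: "x \<in> fst c" "p = snd c x" using K(3) by blast
    then have cx: "c \<in> charts_at M x" using c by (simp add: charts_at_def)
    have "x \<in> topspace (mtop M)" using sm c x by (auto simp: smooth_manifold_def)
    moreover have "tvec_of M x c u \<noteq> (\<lambda>c. 0)"
      using tvec_of_chart[OF sm cx, of u] pu(3) by auto
    ultimately have "rmetric M x (tvec_of M x c u) (tvec_of M x c u) > 0"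
      using M tvec_of_in_tangent_space[OF sm cx] unfolding riemannian_manifold_def by blast
    then show ?thesis by (simp add: pu(1) x(2) G[OF x(1)])
  qed
  moreover from this z'[OF z(1)] have "?q z' > 0" by linarith
  moreover have scale: "blinfun_apply (blinfun_apply (G p) u) u = ?q (p, u /\<^sub>R norm u) * (norm u)\<^sup>2" for p u
    by (cases "u = 0") (simp_all add: blinfun.bilinear_simps power2_eq_square field_simps)
  have "?q z * (norm u)\<^sup>2 \<le> blinfun_apply (blinfun_apply (G p) u) u \<and>
    blinfun_apply (blinfun_apply (G p) u) u \<le> ?q z' * (norm u)\<^sup>2" if "p \<in> K" for p u
  proof (cases "u = 0")
    case False
    then have "(p, u /\<^sub>R norm u) \<in> ?S" using that by simp
    then have "?q z \<le> ?q (p, u /\<^sub>R norm u)" "?q (p, u /\<^sub>R norm u) \<le> ?q z'"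
      by (blast intro: z(2) z')+
    then show ?thesis by (subst (1 2) scale) (intro conjI mult_right_mono zero_le_power2)
  qed simp
  ultimately show ?thesis by (intro that[of "?q z" "?q z'"]) blast+
qed

section \<open>Bounds for functions on the jet bundle\<close>

text \<open>
  In a chart, the covectors \<open>\<zeta>\<close> with \<open>a \<le> \<bar>\<zeta>\<bar> \<le> b\<close> over a compact ball \<open>K\<close> of coordinates belong to a
  product \<open>K \<times> A\<close> with an annulus \<open>A\<close> of linear functionals. The annulus is compact and, because
  \<open>a > 0\<close>, avoids \<open>0\<close>, so \<open>F(\<zeta>, k I)\<close> is a continuous function on \<open>K \<times> A\<close>.
\<close>

lemma jet_fun_locally_bounded:
  fixes M :: "('a, 'e::euclidean_space) riem" and F :: "('a, 'e) jet_fun"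
  assumes M: "riemannian_manifold M" and F: "jet_continuous M F"
    and x: "x \<in> topspace (mtop M)" and a: "a > 0"
  shows "\<exists>U B. openin (mtop M) U \<and> x \<in> U \<and> (\<forall>y\<in>U. \<forall>\<zeta>\<in>nonzero_covectors M y.
    a \<le> conorm M y \<zeta> \<and> conorm M y \<zeta> \<le> b \<longrightarrow> \<bar>F y \<zeta> (\<lambda>v w. k * rmetric M y v w)\<bar> \<le> B)"
proof -
  have sm: "smooth_manifold M" using M by (simp add: riemannian_manifold_def)
  have "x \<in> \<Union> (fst ` atlas M)" using sm x by (simp add: smooth_manifold_def)
  then obtain c where c: "c \<in> atlas M" "x \<in> fst c" by auto
  obtain G :: "'e \<Rightarrow> 'e \<Rightarrow>\<^sub>L 'e \<Rightarrow>\<^sub>L real" where contG: "continuous_on (snd c ` fst c) G"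
    and G: "\<And>x u w. x \<in> fst c \<Longrightarrow>
      blinfun_apply (blinfun_apply (G (snd c x)) u) w = rmetric M x (tvec_of M x c u) (tvec_of M x c w)"
    using metric_coord_blinfun[OF M c(1)] by blast
  have hom: "homeomorphic_map (subtopology (mtop M) (fst c)) (top_of_set (snd c ` fst c)) (snd c)"
    and opn: "open (snd c ` fst c)" "openin (mtop M) (fst c)"
    using sm c by (auto simp: smooth_manifold_def)
  obtain e where e: "e > 0" "cball (snd c x) e \<subseteq> snd c ` fst c"
    using open_contains_cball_eq[OF opn(1)] c(2) by blast
  define K where "K = cball (snd c x) e"
  have K: "compact K" "K \<noteq> {}" "K \<subseteq> snd c ` fst c"
    using e by (auto simp: K_def)
  have contGK: "continuous_on K G" by (rule continuous_on_subset[OF contG K(3)])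
  obtain l L where l: "l > 0" and L: "L > 0"
    and lo: "\<And>p u. p \<in> K \<Longrightarrow> l * (norm u)\<^sup>2 \<le> blinfun_apply (blinfun_apply (G p) u) u"
    and up: "\<And>p u. p \<in> K \<Longrightarrow> blinfun_apply (blinfun_apply (G p) u) u \<le> L * (norm u)\<^sup>2"
    using metric_uniformly_equivalent_on_compact[OF M c(1) K contGK G] by blast
  \<comment> \<open>By the comparison of norms, the coordinate functionals of covectors over \<open>K\<close> with dual norm in
    \<open>[a, b]\<close> lie in \<open>A\<close>.\<close>
  define A :: "('e \<Rightarrow>\<^sub>L real) set" where "A = cball 0 (sqrt L * b) - ball 0 (a * sqrt l)"
  have "compact A" unfolding A_def by (intro compact_diff) auto
  define H where "H = (\<lambda>(p, \<alpha>). let x = chart_inv c p in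
      F x (covec_of M x c \<alpha>) (form_of M x c (k *\<^sub>R G p)))"
  have "continuous_on (K \<times> A) H"
  proof -
    let ?D = "{(p, \<alpha>, B). p \<in> snd c ` fst c \<and> \<alpha> \<noteq> 0 \<and>
           (\<forall>u w. blinfun_apply (blinfun_apply B u) w = blinfun_apply (blinfun_apply B w) u)}"
    have symG: "blinfun_apply (blinfun_apply (G p) u) w = blinfun_apply (blinfun_apply (G p) w) u"
      if "p \<in> K" for p u w
    proof -
      obtain y where y: "y \<in> fst c" "p = snd c y" using \<open>p \<in> K\<close> K(3) by blast
      then have "y \<in> topspace (mtop M)" using sm c by (auto simp: smooth_manifold_def)
      then show ?thesis
        using M by (simp add: y G riemannian_manifold_def sym_forms_def)
    qed
    have "(\<lambda>(p, \<alpha>). (p, \<alpha>, k *\<^sub>R G p)) ` (K \<times> A) \<subseteq> ?D"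
      using K(3) symG a l by (auto simp: A_def blinfun.scaleR_left)
    moreover have "continuous_on (K \<times> A) (\<lambda>(p, \<alpha>). (p, \<alpha>, k *\<^sub>R G p))"
      unfolding case_prod_unfold
      by (intro continuous_intros continuous_on_compose2[OF contGK]) auto
    moreover have "continuous_on ?D (\<lambda>(p, \<alpha>, B). let x = chart_inv c p in
        F x (covec_of M x c \<alpha>) (form_of M x c B))"
      using F c unfolding jet_continuous_def by blast
    ultimately have "continuous_on (K \<times> A) ((\<lambda>(p, \<alpha>, B). let x = chart_inv c p in
        F x (covec_of M x c \<alpha>) (form_of M x c B)) \<circ> (\<lambda>(p, \<alpha>). (p, \<alpha>, k *\<^sub>R G p)))"
      by (blast intro: continuous_on_compose continuous_on_subset)
    then show ?thesis by (simp add: H_def o_def case_prod_unfold)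
  qed
  then have "bounded (H ` (K \<times> A))"
    using K(1) \<open>compact A\<close> by (intro compact_imp_bounded compact_continuous_image compact_Times)
  then obtain B where B: "\<And>p \<alpha>. p \<in> K \<Longrightarrow> \<alpha> \<in> A \<Longrightarrow> \<bar>H (p, \<alpha>)\<bar> \<le> B"
    unfolding bounded_iff by (metis SigmaI image_eqI real_norm_def)
  define U where "U = {y \<in> fst c. snd c y \<in> ball (snd c x) e}"
  show ?thesis
  proof (intro exI conjI ballI impI)
    have "openin (subtopology (mtop M) (fst c))
        {y \<in> topspace (subtopology (mtop M) (fst c)). snd c y \<in> snd c ` fst c \<inter> ball (snd c x) e}"
      by (intro openin_continuous_map_preimage[OF homeomorphic_imp_continuous_map[OF hom]]) auto
    moreover have "{y \<in> topspace (subtopology (mtop M) (fst c)). snd c y \<in> snd c ` fst c \<inter> ball (snd c x) e} = U"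
      using openin_subset[OF opn(2)] by (auto simp: U_def)
    ultimately show "openin (mtop M) U"
      using opn(2) by (simp add: openin_open_subtopology)
    show "x \<in> U" using c e by (simp add: U_def)
    fix y \<zeta> assume y: "y \<in> U" and \<zeta>: "\<zeta> \<in> nonzero_covectors M y"
      and "a \<le> conorm M y \<zeta> \<and> conorm M y \<zeta> \<le> b"
    then have con: "a \<le> conorm M y \<zeta>" "conorm M y \<zeta> \<le> b" by auto
    have yc: "y \<in> fst c" "snd c y \<in> K" using y by (auto simp: U_def K_def)
    have cy: "c \<in> charts_at M y" using c yc by (simp add: charts_at_def)
    obtain \<alpha> where \<alpha>: "\<zeta> = covec_of M y c \<alpha>"
      using covector_eq_covec_of[OF sm cy] \<zeta> by (auto simp: nonzero_covectors_def)
    note bnd = conorm_covec_of_bounds[OF M cy l L lo[OF yc(2), unfolded G[OF yc(1)]]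
        up[OF yc(2), unfolded G[OF yc(1)]], of \<alpha>, folded \<alpha>]
    have "a \<le> norm \<alpha> / sqrt l" using con(1) bnd(1) by linarith
    then have "a * sqrt l \<le> norm \<alpha>" using l by (simp add: field_simps)
    moreover have "sqrt L * conorm M y \<zeta> \<le> sqrt L * b" using con(2) L by simp
    then have "norm \<alpha> \<le> sqrt L * b" using bnd(2) by linarith
    ultimately have "\<bar>H (snd c y, \<alpha>)\<bar> \<le> B" using yc(2) by (intro B) (auto simp: A_def)
    then show "\<bar>F y \<zeta> (\<lambda>v w. k * rmetric M y v w)\<bar> \<le> B"
      by (simp add: H_def chart_inv_chart[OF sm cy] \<alpha> metric_eq_form_of[OF M cy G[OF yc(1)]])
  qed
qed

text \<open>
  Apply the comparison of norms over the single point \<open>x\<close>: a nonzero covector has a nonzero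
  coordinate functional.
\<close>

lemma conorm_nonzero_covector_pos:
  fixes M :: "('a, 'e::euclidean_space) riem"
  assumes M: "riemannian_manifold M" and x: "x \<in> topspace (mtop M)"
    and \<zeta>: "\<zeta> \<in> nonzero_covectors M x"
  shows "conorm M x \<zeta> > 0"
proof -
  have sm: "smooth_manifold M" using M by (simp add: riemannian_manifold_def)
  have "x \<in> \<Union> (fst ` atlas M)" using sm x by (simp add: smooth_manifold_def)
  then obtain c where c: "c \<in> atlas M" "x \<in> fst c" by auto
  then have cx: "c \<in> charts_at M x" by (simp add: charts_at_def)
  obtain G :: "'e \<Rightarrow> 'e \<Rightarrow>\<^sub>L 'e \<Rightarrow>\<^sub>L real" where
    "continuous_on (snd c ` fst c) G" and G: "\<And>x u w. x \<in> fst c \<Longrightarrow>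
      blinfun_apply (blinfun_apply (G (snd c x)) u) w = rmetric M x (tvec_of M x c u) (tvec_of M x c w)"
    using metric_coord_blinfun[OF M c(1)] by blast
  have K: "compact {snd c x}" "{snd c x} \<noteq> {}" "{snd c x} \<subseteq> snd c ` fst c" "continuous_on {snd c x} G"
    using c by auto
  obtain l L where l: "l > 0" and L: "L > 0"
    and lo: "\<And>p u. p \<in> {snd c x} \<Longrightarrow> l * (norm u)\<^sup>2 \<le> blinfun_apply (blinfun_apply (G p) u) u"
    and up: "\<And>p u. p \<in> {snd c x} \<Longrightarrow> blinfun_apply (blinfun_apply (G p) u) u \<le> L * (norm u)\<^sup>2"
    using metric_uniformly_equivalent_on_compact[OF M c(1) K G] by blast
  obtain \<alpha> where \<alpha>: "\<zeta> = covec_of M x c \<alpha>"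
    using covector_eq_covec_of[OF sm cx] \<zeta> by (auto simp: nonzero_covectors_def)
  have "\<alpha> \<noteq> 0" using \<zeta> \<alpha> by (auto simp: nonzero_covectors_def covec_of_def)
  note bnd = conorm_covec_of_bounds[OF M cx l L lo[OF singletonI, unfolded G[OF c(2)]]
        up[OF singletonI, unfolded G[OF c(2)]], of \<alpha>, folded \<alpha>]
  have "0 < sqrt L * conorm M x \<zeta>"
    using bnd(2) \<open>\<alpha> \<noteq> 0\<close> by (smt (verit) zero_less_norm_iff)
  then show ?thesis using L by (simp add: zero_less_mult_iff)
qed

lemma jet_fun_bounded:
  fixes M :: "('a, 'e::euclidean_space) riem" and F :: "('a, 'e) jet_fun"
  assumes M: "riemannian_manifold M" and comp: "compact_space (mtop M)" and F: "jet_continuous M F"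
    and a: "a > 0"
  obtains B where "\<And>x \<zeta>. x \<in> topspace (mtop M) \<Longrightarrow> \<zeta> \<in> nonzero_covectors M x \<Longrightarrow>
    a \<le> conorm M x \<zeta> \<Longrightarrow> conorm M x \<zeta> \<le> b \<Longrightarrow> \<bar>F x \<zeta> (\<lambda>v w. k * rmetric M x v w)\<bar> \<le> B"
proof -
  define bdd where "bdd = (\<lambda>U B. \<forall>y\<in>U. \<forall>\<zeta>\<in>nonzero_covectors M y.
      a \<le> conorm M y \<zeta> \<and> conorm M y \<zeta> \<le> b \<longrightarrow> \<bar>F y \<zeta> (\<lambda>v w. k * rmetric M y v w)\<bar> \<le> B)"
  define \<U> where "\<U> = {U. openin (mtop M) U \<and> (\<exists>B. bdd U B)}"
  have "\<exists>U\<in>\<U>. x \<in> U" if x: "x \<in> topspace (mtop M)" for x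
  proof -
    obtain U B where "openin (mtop M) U" "x \<in> U" "bdd U B"
      using jet_fun_locally_bounded[OF M F x a, of b k] unfolding bdd_def by blast
    then show ?thesis unfolding \<U>_def by blast
  qed
  then have cover: "(\<forall>U\<in>\<U>. openin (mtop M) U) \<and> topspace (mtop M) \<subseteq> \<Union>\<U>"
    unfolding \<U>_def by blast
  have "\<exists>\<V>. finite \<V> \<and> \<V> \<subseteq> \<U> \<and> topspace (mtop M) \<subseteq> \<Union>\<V>"
    by (rule comp[unfolded compact_space_alt, THEN spec, THEN mp, OF cover])
  then obtain \<V> where \<V>: "finite \<V>" "\<V> \<subseteq> \<U>" "topspace (mtop M) \<subseteq> \<Union>\<V>" by blast
  then have "\<forall>U\<in>\<V>. \<exists>B. bdd U B" by (auto simp: \<U>_def)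
  then obtain B where B: "\<And>U. U \<in> \<V> \<Longrightarrow> bdd U (B U)" by metis
  show ?thesis
  proof
    fix x \<zeta> assume x: "x \<in> topspace (mtop M)" "\<zeta> \<in> nonzero_covectors M x"
      "a \<le> conorm M x \<zeta>" "conorm M x \<zeta> \<le> b"
    then obtain U where U: "U \<in> \<V>" "x \<in> U" using \<V>(3) by blast
    then have "\<bar>F x \<zeta> (\<lambda>v w. k * rmetric M x v w)\<bar> \<le> B U"
      using B[OF U(1)] x unfolding bdd_def by blast
    also have "\<dots> \<le> Max (B ` \<V>)" using \<V>(1) U(1) by simp
    finally show "\<bar>F x \<zeta> (\<lambda>v w. k * rmetric M x v w)\<bar> \<le> Max (B ` \<V>)" .
  qed
qed

section \<open>Existence of an admissible function\<close>

theorem proposition2p5: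
  fixes M :: "('a, 'e::euclidean_space) riem" and F :: "('a, 'e) jet_fun"
  assumes "riemannian_manifold M" and "compact_space (mtop M)"
    and "jet_continuous M F" and "degenerate_elliptic M F"
    and "translation_invariant M F" and "geometric M F"
  shows "admissible_functions M F \<noteq> {}"
proof -
  define I where "I = (SIGMA x:topspace (mtop M). nonzero_covectors M x)"
  define \<rho> where "\<rho> = (\<lambda>(x, \<zeta>). conorm M x \<zeta>)"
  define \<Phi> where "\<Phi> = (\<lambda>k (x, \<zeta>). F x \<zeta> (\<lambda>v w. k * rmetric M x v w))"
  have pos: "\<rho> i > 0" if "i \<in> I" for i
    using that conorm_nonzero_covector_pos[OF assms(1)] by (auto simp: I_def \<rho>_def)
  have "\<exists>B. \<forall>i\<in>I. a \<le> \<rho> i \<and> \<rho> i \<le> 1 \<longrightarrow> \<bar>\<bar>\<Phi> 2 i\<bar> + \<bar>\<Phi> (-2) i\<bar>\<bar> \<le> B" if "a > 0" for a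
  proof -
    have "\<exists>B. \<forall>i\<in>I. a \<le> \<rho> i \<and> \<rho> i \<le> 1 \<longrightarrow> \<bar>\<Phi> k i\<bar> \<le> B" for k
      using jet_fun_bounded[OF assms(1-3) that, of 1 k]
      unfolding I_def \<rho>_def \<Phi>_def by (smt (verit) SigmaE case_prod_conv)
    then obtain B where "\<And>k. \<forall>i\<in>I. a \<le> \<rho> i \<and> \<rho> i \<le> 1 \<longrightarrow> \<bar>\<Phi> k i\<bar> \<le> B k" by metis
    from this[of 2] this[of "-2"] show ?thesis
      by (intro exI[of _ "B 2 + B (-2)"]) fastforce
  qed
  from flat_weight[of I \<rho> "\<lambda>i. \<bar>\<Phi> 2 i\<bar> + \<bar>\<Phi> (-2) i\<bar>", OF pos this]
  obtain g where g: "continuous_on UNIV g" "mono g" "g 0 = 0" "\<And>s. s > 0 \<Longrightarrow> g s > 0"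
    and g_le: "\<And>i. i \<in> I \<Longrightarrow> \<rho> i \<le> 1 \<Longrightarrow> g (\<rho> i) * \<bar>\<bar>\<Phi> 2 i\<bar> + \<bar>\<Phi> (-2) i\<bar>\<bar> \<le> \<rho> i"
    by blast
  define f' where "f' = (\<lambda>s. integral {0..s} g)"
  define f where "f = (\<lambda>s. integral {0..s} f')"
  have contg: "continuous_on A g" for A using g(1) by (rule continuous_on_subset) simp
  have f': "(f' has_real_derivative g s) (at s within {0..})" if "s \<ge> 0" for s
    unfolding f'_def by (rule integral_has_real_derivative_halfline[OF contg that])
  then have contf': "continuous_on {0..} f'"
    by (intro DERIV_continuous_on) auto
  have f: "(f has_real_derivative f' s) (at s within {0..})" if "s \<ge> 0" for s
    unfolding f_def by (rule integral_has_real_derivative_halfline[OF contf' that])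
  have f'_bounds: "0 \<le> f' s" "f' s \<le> g s * s" if "s > 0" for s
  proof -
    have int: "g integrable_on {0..s}" by (rule integrable_continuous_real[OF contg])
    have gpos: "0 \<le> g t" if "t \<ge> 0" for t using g(3) monoD[OF g(2) that] by simp
    show "0 \<le> f' s" unfolding f'_def by (intro integral_nonneg[OF int]) (use gpos in auto)
    have "f' s \<le> integral {0..s} (\<lambda>_. g s)"
      unfolding f'_def by (intro integral_le[OF int]) (use monoD[OF g(2)] in auto)
    then show "f' s \<le> g s * s" using that by (simp add: mult.commute)
  qed
  have lim: "((\<lambda>i. f' (\<rho> i) / \<rho> i * \<Phi> k i) \<longlongrightarrow> 0) (covectors_to_0 M)" if k: "k \<in> {2, -2}" for k
  proof (rule Lim_null_comparison)
    have evI: "\<forall>\<^sub>F i in covectors_to_0 M. i \<in> I"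
      unfolding covectors_to_0_def I_def
      by (rule filter_leD[OF inf_le2]) (simp add: eventually_principal)
    show \<rho>0: "(\<rho> \<longlongrightarrow> 0) (covectors_to_0 M)"
      unfolding covectors_to_0_def \<rho>_def
      by (rule filterlim_mono[OF filterlim_filtercomap order_refl inf_le1])
    have "\<forall>\<^sub>F i in covectors_to_0 M. \<rho> i < 1" using \<rho>0 by (rule order_tendstoD) simp
    with evI show "\<forall>\<^sub>F i in covectors_to_0 M. norm (f' (\<rho> i) / \<rho> i * \<Phi> k i) \<le> \<rho> i"
    proof eventually_elim
      case (elim i)
      note p = pos[OF elim(1)]
      have "norm (f' (\<rho> i) / \<rho> i * \<Phi> k i) = f' (\<rho> i) / \<rho> i * \<bar>\<Phi> k i\<bar>"
        using p f'_bounds(1)[OF p] by (simp add: abs_mult)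
      also have "\<dots> \<le> g (\<rho> i) * \<bar>\<bar>\<Phi> 2 i\<bar> + \<bar>\<Phi> (-2) i\<bar>\<bar>"
        using p f'_bounds[OF p] g(4)[OF p] k
        by (intro mult_mono) (auto simp: field_simps)
      also have "\<dots> \<le> \<rho> i" using elim by (intro g_le) auto
      finally show ?case .
    qed
  qed
  have "f \<in> admissible_functions M F"
    unfolding admissible_functions_def
  proof (rule CollectI, rule exI[of _ f'], rule exI[of _ g], intro conjI allI impI)
    show "f 0 = 0" "f' 0 = 0" by (simp_all add: f_def f'_def)
    show "((\<lambda>(x, \<zeta>). f' (conorm M x \<zeta>) / conorm M x \<zeta> * F x \<zeta> (\<lambda>v w. 2 * rmetric M x v w))
        \<longlongrightarrow> 0) (covectors_to_0 M)"
      using lim[of 2] by (simp add: \<rho>_def \<Phi>_def case_prod_unfold)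
    show "((\<lambda>(x, \<zeta>). f' (conorm M x \<zeta>) / conorm M x \<zeta> * F x \<zeta> (\<lambda>v w. - 2 * rmetric M x v w))
        \<longlongrightarrow> 0) (covectors_to_0 M)"
      using lim[of "-2"] by (simp add: \<rho>_def \<Phi>_def case_prod_unfold)
  qed (use f f' contg g in auto)
  then show ?thesis by blast
qed

end
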